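(* Let $\gamma_1,\gamma_2,\gamma_3\in\tilde{\mathbb I}$ be intuitionistic fuzzy values and let $T$ be a continuous t-norm. Then for all $\zeta,\xi,\lambda>0$: (i) $\gamma_1\oplus_T\gamma_2=\gamma_2\oplus_T\gamma_1$; (ii) $\gamma_1\otimes_T\gamma_2=\gamma_2\otimes_T\gamma_1$; (iii) $(\gamma_1\oplus_T\gamma_2)\oplus_T\gamma_3=\gamma_1\oplus_T(\gamma_2\oplus_T\gamma_3)$; (iv) $(\gamma_1\otimes_T\gamma_2)\otimes_T\gamma_3=\gamma_1\otimes_T(\gamma_2\otimes_T\gamma_3)$; (v) $(\xi_T\gamma_1)\oplus_T(\zeta_T\gamma_1)=(\xi+\zeta)_T\gamma_1$; (vi) $(\gamma_1^{\xi_T})\otimes_T(\gamma_1^{\zeta_T})=\gamma_1^{(\xi+\zeta)_T}$. Moreover, if $T=T_{\mathbf M}$ (the minimum), or $T$ is a strict t-norm, or $T$ is an ordinal sum of strict t-norms, then: (vii) $\lambda_T(\gamma_1\oplus_T\gamma_2)=\lambda_T\gamma_1\oplus_T\lambda_T\gamma_2$; (viii) $(\gamma_1\otimes_T\gamma_2)^{\lambda_T}=\gamma_1^{\lambda_T}\otimes_T\gamma_2^{\lambda_T}$; (ix) $(\gamma_1^{\lambda_T})^{\xi_T}=\gamma_1^{(\lambda\cdot\xi)_T}$; (x) $\xi_T(\lambda_T\gamma_1)=(\lambda\cdot\xi)_T\gamma_1$.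
   Context: A t-norm is a map $T:[0,1]^2\to[0,1]$ that is commutative, associative, nondecreasing in each argument, with $T(x,1)=x$; a t-conorm $S$ satisfies the same with $S(x,0)=x$ in place of $T(x,1)=x$. The dual t-conorm of $T$ is $S(x,y)=1-T(1-x,1-y)$. A continuous t-norm is strict if $T(x,y)<T(x,z)$ whenever $x>0$ and $y<z$. $T$ is an ordinal sum of strict t-norms if there are a (finite or countably infinite) index set $\mathscr A$, strict t-norms $\{T_\lambda\}_{\lambda\in\mathscr A}$ and non-empty pairwise disjoint open subintervals $\{(a_\lambda,e_\lambda)\}_{\lambda\in\mathscr A}$ of $[0,1]$ with $T(u,v)=a_\lambda+(e_\lambda-a_\lambda)T_\lambda\left(\frac{u-a_\lambda}{e_\lambda-a_\lambda},\frac{v-a_\lambda}{e_\lambda-a_\lambda}\right)$ for $(u,v)\in[a_\lambda,e_\lambda]^2$ and $T(u,v)=\min\{u,v\}$ otherwise. Powers: $\mathbb N=\{1,2,\dots\}$. $x_T^{(0)}=1$, $x_T^{(1)}=x$, $x_T^{(n)}=T(x_T^{(n-1)},x)$, and $x_S^{(0)}=0$, $x_S^{(1)}=x$, $x_S^{(n)}=S(x_S^{(n-1)},x)$. For $T,S$ continuous, $u\in[0,1]$, $p,q\in\mathbb N$: $u_T^{(1/p)}=\sup\{v\in[0,1]\mid v_T^{(p)}<u\}$ ($\sup\varnothing=0$), $u_S^{(1/p)}=\inf\{v\in[0,1]\mid v_S^{(p)}>u\}$ ($\inf\varnothing=1$), $u_T^{(q/p)}=(u_T^{(1/p)})_T^{(q)}$,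 $u_S^{(q/p)}=(u_S^{(1/p)})_S^{(q)}$ (independent of the representation of the fraction). For real $t>0$: $u_T^{(t)}=\inf\{u_T^{(r)}\mid r\in[0,t]\cap\mathbb Q\}$ and $u_S^{(t)}=\sup\{u_S^{(r)}\mid r\in[0,t]\cap\mathbb Q\}$ (these agree with the preceding definitions for rational $t>0$). Intuitionistic fuzzy values (IFVs): $\tilde{\mathbb I}=\{\langle\mu,\nu\rangle\in[0,1]^2\mid\mu+\nu\le1\}$; $\alpha\in\tilde{\mathbb I}$ is written $\langle\mu_\alpha,\nu_\alpha\rangle$. For a continuous t-norm $T$ with dual t-conorm $S$, $\alpha,\beta\in\tilde{\mathbb I}$ and $\lambda>0$: $\alpha\oplus_T\beta=\langle S(\mu_\alpha,\mu_\beta),T(\nu_\alpha,\nu_\beta)\rangle$; $\alpha\otimes_T\beta=\langle T(\mu_\alpha,\mu_\beta),S(\nu_\alpha,\nu_\beta)\rangle$; $\lambda_T\alpha=\langle(\mu_\alpha)_S^{(\lambda)},(\nu_\alpha)_T^{(\lambda)}\rangle$; $\alpha^{\lambda_T}=\langle(\mu_\alpha)_T^{(\lambda)},(\nu_\alpha)_S^{(\lambda)}\rangle$. *)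

theory Defs
  imports "HOL-Analysis.Analysis"
begin

text \<open>Operations on the unit interval are functions on the reals of which only the values on
  \<open>[0,1]\<^sup>2\<close> matter; every condition and every equality below is relativised to \<open>{0..1}\<close>.\<close>

definition tnorm :: "(real \<Rightarrow> real \<Rightarrow> real) \<Rightarrow> bool" where
  "tnorm T \<longleftrightarrow>
     (\<forall>x\<in>{0..1}. \<forall>y\<in>{0..1}. T x y \<in> {0..1}) \<and>
     (\<forall>x\<in>{0..1}. \<forall>y\<in>{0..1}. T x y = T y x) \<and>
     (\<forall>x\<in>{0..1}. \<forall>y\<in>{0..1}. \<forall>z\<in>{0..1}. T (T x y) z = T x (T y z)) \<and>
     (\<forall>x\<in>{0..1}. \<forall>x'\<in>{0..1}. \<forall>y\<in>{0..1}. \<forall>y'\<in>{0..1}.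
        x \<le> x' \<longrightarrow> y \<le> y' \<longrightarrow> T x y \<le> T x' y') \<and>
     (\<forall>x\<in>{0..1}. T x 1 = x)"

definition continuous_tnorm :: "(real \<Rightarrow> real \<Rightarrow> real) \<Rightarrow> bool" where
  "continuous_tnorm T \<longleftrightarrow> tnorm T \<and> continuous_on ({0..1} \<times> {0..1}) (\<lambda>(x, y). T x y)"

definition strict_tnorm :: "(real \<Rightarrow> real \<Rightarrow> real) \<Rightarrow> bool" where
  "strict_tnorm T \<longleftrightarrow> continuous_tnorm T \<and>
     (\<forall>x\<in>{0..1}. \<forall>y\<in>{0..1}. \<forall>z\<in>{0..1}. 0 < x \<longrightarrow> y < z \<longrightarrow> T x y < T x z)"

definition minimum_tnorm :: "(real \<Rightarrow> real \<Rightarrow> real) \<Rightarrow> bool" where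
  "minimum_tnorm T \<longleftrightarrow> (\<forall>x\<in>{0..1}. \<forall>y\<in>{0..1}. T x y = min x y)"

text \<open>Finite and countably infinite index sets are represented by sets of natural numbers.\<close>

definition ordinal_sum_of_strict :: "(real \<Rightarrow> real \<Rightarrow> real) \<Rightarrow> bool" where
  "ordinal_sum_of_strict T \<longleftrightarrow>
     (\<exists>(A :: nat set) (T' :: nat \<Rightarrow> real \<Rightarrow> real \<Rightarrow> real) (a :: nat \<Rightarrow> real) (e :: nat \<Rightarrow> real).
        (\<forall>l\<in>A. strict_tnorm (T' l)) \<and>
        (\<forall>l\<in>A. 0 \<le> a l \<and> a l < e l \<and> e l \<le> 1) \<and>
        disjoint_family_on (\<lambda>l. {a l<..<e l}) A \<and>
        (\<forall>l\<in>A. \<forall>u\<in>{a l..e l}. \<forall>v\<in>{a l..e l}.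
           T u v = a l + (e l - a l) * T' l ((u - a l) / (e l - a l)) ((v - a l) / (e l - a l))) \<and>
        (\<forall>u\<in>{0..1}. \<forall>v\<in>{0..1}.
           \<not> (\<exists>l\<in>A. u \<in> {a l..e l} \<and> v \<in> {a l..e l}) \<longrightarrow> T u v = min u v))"

definition dual_conorm :: "(real \<Rightarrow> real \<Rightarrow> real) \<Rightarrow> real \<Rightarrow> real \<Rightarrow> real" where
  "dual_conorm T x y = 1 - T (1 - x) (1 - y)"

fun tpow_nat :: "(real \<Rightarrow> real \<Rightarrow> real) \<Rightarrow> real \<Rightarrow> nat \<Rightarrow> real" where
  "tpow_nat T x 0 = 1"
| "tpow_nat T x (Suc 0) = x"
| "tpow_nat T x (Suc (Suc n)) = T (tpow_nat T x (Suc n)) x"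

fun spow_nat :: "(real \<Rightarrow> real \<Rightarrow> real) \<Rightarrow> real \<Rightarrow> nat \<Rightarrow> real" where
  "spow_nat S x 0 = 0"
| "spow_nat S x (Suc 0) = x"
| "spow_nat S x (Suc (Suc n)) = S (spow_nat S x (Suc n)) x"

text \<open>The case distinctions implement the conventions \<open>sup \<emptyset> = 0\<close> and \<open>inf \<emptyset> = 1\<close>.\<close>

definition troot :: "(real \<Rightarrow> real \<Rightarrow> real) \<Rightarrow> nat \<Rightarrow> real \<Rightarrow> real" where
  "troot T p u = (let V = {v \<in> {0..1}. tpow_nat T v p < u} in if V = {} then 0 else Sup V)"

definition sroot :: "(real \<Rightarrow> real \<Rightarrow> real) \<Rightarrow> nat \<Rightarrow> real \<Rightarrow> real" where
  "sroot S p u = (let V = {v \<in> {0..1}. spow_nat S v p > u} in if V = {} then 1 else Inf V)"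

text \<open>For \<open>r \<ge> 0\<close>, \<^const>\<open>quotient_of\<close> yields the reduced fraction \<open>r = q/p\<close> with \<open>p > 0\<close>.\<close>

definition tpow_rat :: "(real \<Rightarrow> real \<Rightarrow> real) \<Rightarrow> real \<Rightarrow> rat \<Rightarrow> real" where
  "tpow_rat T u r = (case quotient_of r of (q, p) \<Rightarrow> tpow_nat T (troot T (nat p) u) (nat q))"

definition spow_rat :: "(real \<Rightarrow> real \<Rightarrow> real) \<Rightarrow> real \<Rightarrow> rat \<Rightarrow> real" where
  "spow_rat S u r = (case quotient_of r of (q, p) \<Rightarrow> spow_nat S (sroot S (nat p) u) (nat q))"

definition tpow :: "(real \<Rightarrow> real \<Rightarrow> real) \<Rightarrow> real \<Rightarrow> real \<Rightarrow> real" where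
  "tpow T u t = Inf {tpow_rat T u r | r. 0 \<le> r \<and> of_rat r \<le> t}"

definition spow :: "(real \<Rightarrow> real \<Rightarrow> real) \<Rightarrow> real \<Rightarrow> real \<Rightarrow> real" where
  "spow S u t = Sup {spow_rat S u r | r. 0 \<le> r \<and> of_rat r \<le> t}"

text \<open>An intuitionistic fuzzy value is a pair \<open>(\<mu>, \<nu>)\<close> of a membership and a
  non-membership degree.\<close>

definition IFV :: "(real \<times> real) set" where
  "IFV = {(\<mu>, \<nu>). \<mu> \<in> {0..1} \<and> \<nu> \<in> {0..1} \<and> \<mu> + \<nu> \<le> 1}"

definition ifv_add ::
  "(real \<Rightarrow> real \<Rightarrow> real) \<Rightarrow> real \<times> real \<Rightarrow> real \<times> real \<Rightarrow> real \<times> real" where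
  "ifv_add T \<alpha> \<beta> = (dual_conorm T (fst \<alpha>) (fst \<beta>), T (snd \<alpha>) (snd \<beta>))"

definition ifv_mult ::
  "(real \<Rightarrow> real \<Rightarrow> real) \<Rightarrow> real \<times> real \<Rightarrow> real \<times> real \<Rightarrow> real \<times> real" where
  "ifv_mult T \<alpha> \<beta> = (T (fst \<alpha>) (fst \<beta>), dual_conorm T (snd \<alpha>) (snd \<beta>))"

definition ifv_scale ::
  "(real \<Rightarrow> real \<Rightarrow> real) \<Rightarrow> real \<Rightarrow> real \<times> real \<Rightarrow> real \<times> real" where
  "ifv_scale T t \<alpha> = (spow (dual_conorm T) (fst \<alpha>) t, tpow T (snd \<alpha>) t)"

definition ifv_pow ::
  "(real \<Rightarrow> real \<Rightarrow> real) \<Rightarrow> real \<times> real \<Rightarrow> real \<Rightarrow> real \<times> real" where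
  "ifv_pow T \<alpha> t = (tpow T (fst \<alpha>) t, spow (dual_conorm T) (snd \<alpha>) t)"

end

theory Submission
  imports Defs
begin

text \<open>
  Each component of each identity is a statement about \<open>T\<close> alone: the map \<open>x \<mapsto> 1 - x\<close> carries
  \<open>T\<close> to its dual conorm, and roots and powers along with it, so
  \<open>u\<^sub>S\<^sup>(\<^sup>t\<^sup>)\<close> equals \<open>1 - (1 - u)\<^sub>T\<^sup>(\<^sup>t\<^sup>)\<close> (\<open>spow_dual\<close>). What remains, for a fixed continuous t-norm and
  with \<open>u\<^sup>t\<close> for \<open>tpow T u t\<close>, are the laws of exponents \<open>T u\<^sup>s u\<^sup>t = u\<^sup>s\<^sup>+\<^sup>t\<close> in general, and
  \<open>(T u v)\<^sup>t = T u\<^sup>t v\<^sup>t\<close> and \<open>(u\<^sup>s)\<^sup>t = u\<^sup>s\<^sup>t\<close> in the special classes.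

  All three are checked on rational exponents and extended by continuity in the exponent.
  The supremum defining the \<open>p\<close>-th root is the least \<open>v\<close> whose \<open>p\<close>-th power
  reaches \<open>u\<close>, and this power equals \<open>u\<close>. Being least, the roots are compatible with refining the
  denominator (\<open>troot_mult\<close>), which makes rational powers additive even when \<open>T\<close> has nilpotent
  elements and \<open>p\<close>-th roots are far from unique.

  Continuity on \<open>{0<..}\<close> comes from the limit \<open>L\<close> of \<open>u\<^sup>1\<^sup>/\<^sup>n\<close>. It need not be \<open>1\<close>, but it is
  idempotent, and an idempotent \<open>L\<close> of a continuous t-norm satisfies \<open>T x L = x\<close> for all
  \<open>x \<le> L\<close>. Hence multiplying \<open>u\<^sup>r\<close> by \<open>u\<^sup>1\<^sup>/\<^sup>n\<close> moves it by an amount that tends to \<open>0\<close>, uniformly in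
  \<open>r > 0\<close> (\<open>tpow_rat_small_step\<close>).

  The remaining laws need roots to commute with \<open>T\<close> and with powers, for which it is enough that
  roots be unique. The minimum, strict t-norms and their ordinal sums have in common that
  \<open>x \<mapsto> T x x\<close> is strictly increasing, and this alone makes every \<open>p\<close>-th power injective
  (\<open>pow_inj\<close>).
\<close>

section \<open>Continuous t-norms and their integer powers\<close>

locale cont_tnorm =
  fixes T :: "real \<Rightarrow> real \<Rightarrow> real"
  assumes cont: "continuous_tnorm T"
begin

lemma T_in [simp]: "x \<in> {0..1} \<Longrightarrow> y \<in> {0..1} \<Longrightarrow> T x y \<in> {0..1}"
  and T_comm: "x \<in> {0..1} \<Longrightarrow> y \<in> {0..1} \<Longrightarrow> T x y = T y x"
  and T_assoc: "x \<in> {0..1} \<Longrightarrow> y \<in> {0..1} \<Longrightarrow> z \<in> {0..1} \<Longrightarrow> T (T x y) z = T x (T y z)"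
  and T_mono: "x \<in> {0..1} \<Longrightarrow> x' \<in> {0..1} \<Longrightarrow> y \<in> {0..1} \<Longrightarrow> y' \<in> {0..1} \<Longrightarrow>
     x \<le> x' \<Longrightarrow> y \<le> y' \<Longrightarrow> T x y \<le> T x' y'"
  and T_one: "x \<in> {0..1} \<Longrightarrow> T x 1 = x"
  using cont unfolding continuous_tnorm_def tnorm_def by blast+

lemma T_one_left: "x \<in> {0..1} \<Longrightarrow> T 1 x = x"
  using T_comm[of 1 x] T_one[of x] by simp

lemma T_le_left: "x \<in> {0..1} \<Longrightarrow> y \<in> {0..1} \<Longrightarrow> T x y \<le> x"
  using T_mono[of x x y 1] T_one[of x] by simp

lemma T_zero_left: "x \<in> {0..1} \<Longrightarrow> T 0 x = 0"
  using T_le_left[of 0 x] T_in[of 0 x] by simp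

lemma T_left_commute:
  "x \<in> {0..1} \<Longrightarrow> y \<in> {0..1} \<Longrightarrow> z \<in> {0..1} \<Longrightarrow> T x (T y z) = T y (T x z)"
  by (metis T_assoc T_comm)

lemma continuous_on_T:
  assumes "continuous_on S f" "continuous_on S g" "f ` S \<subseteq> {0..1}" "g ` S \<subseteq> {0..1}"
  shows "continuous_on S (\<lambda>x. T (f x) (g x))"
proof -
  have T: "continuous_on ({0..1} \<times> {0..1}) (\<lambda>(x, y). T x y)"
    using cont unfolding continuous_tnorm_def by blast
  have "continuous_on S (\<lambda>x. (f x, g x))"
    using assms by (intro continuous_on_Pair)
  from continuous_on_compose2[OF T this] show ?thesis
    using assms by (auto simp: image_subset_iff)
qed

lemma tendsto_T:
  assumes "f \<longlonglongrightarrow> a" "g \<longlonglongrightarrow> b" "\<And>n. f n \<in> {0..1}" "\<And>n. g n \<in> {0..1}"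
  shows "(\<lambda>n. T (f n) (g n)) \<longlonglongrightarrow> T a b"
proof -
  have T: "continuous_on ({0..1} \<times> {0..1}) (\<lambda>(x, y). T x y)"
    using cont unfolding continuous_tnorm_def by blast
  have "a \<in> {0..1}" "b \<in> {0..1}"
    using assms closed_sequentially[OF closed_atLeastAtMost] by blast+
  then show ?thesis
    using continuous_on_tendsto_compose[OF T tendsto_Pair[OF assms(1,2)]] assms(3,4) by simp
qed

lemma pow_in [simp]: "x \<in> {0..1} \<Longrightarrow> tpow_nat T x n \<in> {0..1}"
  by (induction n rule: induct_nat_012) (simp_all add: T_in[unfolded atLeastAtMost_iff])

lemma pow_Suc: "x \<in> {0..1} \<Longrightarrow> tpow_nat T x (Suc n) = T (tpow_nat T x n) x"
  by (cases n) (simp_all add: T_one_left)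

lemma pow_add:
  "x \<in> {0..1} \<Longrightarrow> tpow_nat T x (m + n) = T (tpow_nat T x m) (tpow_nat T x n)"
  by (induction n) (simp_all add: T_one pow_Suc T_assoc del: atLeastAtMost_iff tpow_nat.simps(2,3))

lemma pow_mult:
  "x \<in> {0..1} \<Longrightarrow> tpow_nat T x (m * n) = tpow_nat T (tpow_nat T x m) n"
  by (induction n)
    (simp_all add: pow_add pow_Suc T_comm del: atLeastAtMost_iff tpow_nat.simps(2,3))

lemma pow_T_distrib:
  assumes "x \<in> {0..1}" "y \<in> {0..1}"
  shows "tpow_nat T (T x y) n = T (tpow_nat T x n) (tpow_nat T y n)"
proof (induction n)
  case (Suc n)
  then show ?case
    using assms by (simp add: pow_Suc T_assoc T_left_commute[of _ x]
        del: atLeastAtMost_iff tpow_nat.simps(2,3))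
qed (simp add: T_one)

lemma pow_mono:
  "x \<in> {0..1} \<Longrightarrow> y \<in> {0..1} \<Longrightarrow> x \<le> y \<Longrightarrow> tpow_nat T x n \<le> tpow_nat T y n"
  by (induction n) (simp_all add: pow_Suc T_mono del: atLeastAtMost_iff tpow_nat.simps(2,3))

lemma pow_zero: "n > 0 \<Longrightarrow> tpow_nat T 0 n = 0"
  by (induction n rule: nat_induct_non_zero) (simp_all add: pow_Suc T_zero_left del: tpow_nat.simps(3))

lemma pow_one: "tpow_nat T 1 n = 1"
  by (induction n) (simp_all add: pow_Suc T_one del: tpow_nat.simps(2,3))

lemma continuous_on_pow: "continuous_on {0..1} (\<lambda>x. tpow_nat T x n)"
proof (induction n)
  case (Suc n)
  then have "continuous_on {0..1} (\<lambda>x. T (tpow_nat T x n) x)"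
    by (intro continuous_on_T) (auto simp: image_subset_iff simp del: atLeastAtMost_iff)
  then show ?case
    by (rule continuous_on_eq) (simp add: pow_Suc)
qed simp

section \<open>Roots\<close>

lemma troot_in [simp]: "troot T p u \<in> {0..1}"
proof (cases "{v \<in> {0..1}. tpow_nat T v p < u} = {}")
  case False
  have "Sup {v \<in> {0..1}. tpow_nat T v p < u} \<in> closure {v \<in> {0..1}. tpow_nat T v p < u}"
    by (rule closure_contains_Sup[OF False]) (auto intro: bdd_aboveI[of _ 1])
  also have "\<dots> \<subseteq> {0..1}"
    by (rule closure_minimal) auto
  finally show ?thesis
    using False by (simp add: troot_def Let_def)
qed (simp add: troot_def)

text \<open>Together with \<open>pow_troot\<close> below this characterises \<open>troot T p u\<close> as the least point of the unit
  interval whose \<open>p\<close>-th power is at least \<open>u\<close>, the form in which it is compared with other roots.\<close>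

lemma troot_le:
  assumes v: "v \<in> {0..1}" and le: "u \<le> tpow_nat T v p"
  shows "troot T p u \<le> v"
proof (cases "{v \<in> {0..1}. tpow_nat T v p < u} = {}")
  case False
  have "w \<le> v" if "w \<in> {0..1}" "tpow_nat T w p < u" for w
    using pow_mono[OF v that(1), of p] le that(2) by fastforce
  then have "Sup {v \<in> {0..1}. tpow_nat T v p < u} \<le> v"
    by (intro cSup_least[OF False]) auto
  then show ?thesis
    unfolding troot_def Let_def using False by (simp only: if_False)
next
  case True
  then show ?thesis
    using v unfolding troot_def Let_def by simp
qed

lemma pow_surj:
  assumes "p > 0" "u \<in> {0..1}"
  obtains z where "z \<in> {0..1}" "tpow_nat T z p = u"
  using IVT'[of "\<lambda>x. tpow_nat T x p" 0 u 1] continuous_on_pow assms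
  by (auto simp: pow_zero pow_one)

text \<open>The supremum cannot stop short of \<open>u\<close>: if its power were smaller, the intermediate value theorem
  between it and an exact root would give a larger point whose power is still below \<open>u\<close>.\<close>

lemma pow_troot:
  assumes p: "p > 0" and u: "u \<in> {0..1}"
  shows "tpow_nat T (troot T p u) p = u"
proof (rule ccontr)
  define s where "s = troot T p u"
  assume "tpow_nat T (troot T p u) p \<noteq> u"
  moreover obtain z where z: "z \<in> {0..1}" "tpow_nat T z p = u"
    using pow_surj[OF assms] .
  moreover have s: "s \<le> z" "s \<in> {0..1}"
    using troot_le[OF z(1)] z(2) by (simp_all add: s_def del: atLeastAtMost_iff)
  ultimately have less: "tpow_nat T s p < u"
    using pow_mono[OF s(2) z(1) s(1), of p] by (simp add: s_def)
  then have "\<exists>w\<ge>s. w \<le> z \<and> tpow_nat T w p = (tpow_nat T s p + u) / 2"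
    using s z by (intro IVT') (auto intro: continuous_on_subset[OF continuous_on_pow])
  then obtain w where w: "s \<le> w" "w \<le> z" "tpow_nat T w p = (tpow_nat T s p + u) / 2"
    by blast
  then have V: "w \<in> {v \<in> {0..1}. tpow_nat T v p < u}"
    using less s z by auto
  then have "w \<le> Sup {v \<in> {0..1}. tpow_nat T v p < u}"
    by (rule cSup_upper) (auto intro: bdd_aboveI[of _ 1])
  then have "w \<le> s"
    using V unfolding s_def troot_def Let_def by (simp split: if_splits) blast
  then show False
    using w less by simp
qed

text \<open>Both sides are \<open>p\<close>-th roots of \<open>u\<close>, and the right-hand side is the least one. The converse
  inequality takes a \<open>k\<close>-th root \<open>z\<close> of the right-hand side: it is a \<open>k * p\<close>-th root of \<open>u\<close>, hence
  not below the least such root.\<close>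

lemma troot_mult:
  assumes k: "k > 0" and p: "p > 0" and u: "u \<in> {0..1}"
  shows "tpow_nat T (troot T (k * p) u) k = troot T p u"
proof (rule antisym)
  obtain z where z: "z \<in> {0..1}" "tpow_nat T z k = troot T p u"
    using pow_surj[OF k troot_in] .
  then have "tpow_nat T z (k * p) = u"
    using pow_troot[OF p u] by (simp add: pow_mult)
  then show "tpow_nat T (troot T (k * p) u) k \<le> troot T p u"
    using pow_mono[OF troot_in z(1) troot_le[OF z(1)], of u "k * p" k] z(2) by simp
next
  have "tpow_nat T (tpow_nat T (troot T (k * p) u) k) p = u"
    using pow_troot[of "k * p" u] assms by (simp add: pow_mult del: atLeastAtMost_iff)
  then show "troot T p u \<le> tpow_nat T (troot T (k * p) u) k"
    by (intro troot_le) (simp_all del: atLeastAtMost_iff)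
qed

section \<open>Rational powers\<close>

lemma nonneg_rat_as_fraction:
  fixes r :: rat
  assumes "r \<ge> 0"
  obtains q p :: nat where "p > 0" "quotient_of r = (int q, int p)" "r = of_nat q / of_nat p"
proof -
  obtain a b where ab: "quotient_of r = (a, b)"
    by (cases "quotient_of r")
  then have b: "b > 0" and r: "r = of_int a / of_int b"
    by (simp_all add: quotient_of_denom_pos quotient_of_div)
  then have "a \<ge> 0"
    using assms by (simp add: zero_le_divide_iff)
  with b have "quotient_of r = (int (nat a), int (nat b))" "nat b > 0" "r = of_nat (nat a) / of_nat (nat b)"
    using ab r by simp_all
  then show thesis
    using that by blast
qed

text \<open>Passing to the common denominator \<open>p * b\<close> shows that an arbitrary fraction gives the same power
  as the reduced one chosen by \<^const>\<open>quotient_of\<close>.\<close>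

lemma tpow_rat_fraction:
  assumes u: "u \<in> {0..1}" and p: "p > 0"
  shows "tpow_rat T u (of_nat q / of_nat p) = tpow_nat T (troot T p u) q"
proof -
  obtain a b :: nat where ab: "b > 0" "quotient_of (of_nat q / of_nat p) = (int a, int b)"
      "(of_nat q / of_nat p :: rat) = of_nat a / of_nat b"
    by (rule nonneg_rat_as_fraction[of "of_nat q / of_nat p"]) simp_all
  then have "(of_nat (q * b) :: rat) = of_nat (a * p)"
    using p by (simp add: field_simps)
  then have eq: "q * b = a * p"
    by (simp only: of_nat_eq_iff)
  have "tpow_nat T (troot T b u) a = tpow_nat T (troot T (p * b) u) (p * a)"
    using troot_mult[OF p ab(1) u] by (simp add: pow_mult del: atLeastAtMost_iff)
  also have "\<dots> = tpow_nat T (troot T (b * p) u) (b * q)"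
    using eq by (simp add: mult.commute)
  also have "\<dots> = tpow_nat T (troot T p u) q"
    using troot_mult[OF ab(1) p u] by (simp add: pow_mult del: atLeastAtMost_iff)
  finally show ?thesis
    using ab(2) by (simp add: tpow_rat_def)
qed

lemma tpow_rat_in [simp]: "tpow_rat T u r \<in> {0..1}"
  by (simp add: tpow_rat_def split: prod.split del: atLeastAtMost_iff)

lemma tpow_rat_add:
  assumes u: "u \<in> {0..1}" and r: "r \<ge> 0" and s: "s \<ge> 0"
  shows "tpow_rat T u (r + s) = T (tpow_rat T u r) (tpow_rat T u s)"
proof -
  obtain a p :: nat where p: "p > 0" "r = of_nat a / of_nat p"
    using nonneg_rat_as_fraction[OF r] by blast
  obtain b q :: nat where q: "q > 0" "s = of_nat b / of_nat q"
    using nonneg_rat_as_fraction[OF s] by blast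
  have "r = of_nat (a * q) / of_nat (p * q)" "s = of_nat (p * b) / of_nat (p * q)"
       "r + s = of_nat (a * q + p * b) / of_nat (p * q)"
    using p q by (simp_all add: field_simps)
  then show ?thesis
    using p q u by (simp only: tpow_rat_fraction mult_pos_pos pow_add troot_in)
qed

lemma tpow_rat_antimono:
  assumes "u \<in> {0..1}" "0 \<le> r" "r \<le> s"
  shows "tpow_rat T u s \<le> tpow_rat T u r"
  using tpow_rat_add[of u r "s - r"] assms by (simp add: T_le_left del: atLeastAtMost_iff)

section \<open>Continuity in the exponent\<close>

text \<open>Continuity enters through divisibility: \<open>x \<le> L\<close> can be written as \<open>T L y\<close>, and the factor \<open>L\<close>
  swallows a second one.\<close>

lemma idempotent_absorbs:
  assumes L: "L \<in> {0..1}" "T L L = L" and x: "x \<in> {0..1}" "x \<le> L"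
  shows "T x L = x"
proof -
  have "continuous_on {0..1} (\<lambda>y. T L y)"
    using L by (intro continuous_on_T) auto
  moreover have "T L 0 = 0" "T L 1 = L"
    using L T_comm[of L 0] by (simp_all add: T_one T_zero_left)
  ultimately obtain y where y: "y \<in> {0..1}" "T L y = x"
    using IVT'[of "\<lambda>y. T L y" 0 x 1] x by auto
  then have "T x L = T (T L L) y"
    using L by (metis T_assoc T_comm T_in)
  then show ?thesis
    using L y by simp
qed

text \<open>The decrease of \<open>u\<^sup>r\<close> over a step of length \<open>1/n\<close> is bounded uniformly in \<open>r\<close>, because
  \<open>u\<^sup>r\<^sup>+\<^sup>1\<^sup>/\<^sup>n\<close> is \<open>T u\<^sup>r u\<^sup>1\<^sup>/\<^sup>n\<close> whereas \<open>T u\<^sup>r L = u\<^sup>r\<close> for the limit \<open>L\<close> of \<open>u\<^sup>1\<^sup>/\<^sup>n\<close>. The exponent \<open>0\<close> is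
  excluded: \<open>u\<^sup>0 = 1\<close> exceeds \<open>L\<close> in general, as for the minimum, where \<open>L = u\<close>.\<close>

lemma tpow_rat_small_step:
  assumes u: "u \<in> {0..1}" and e: "\<epsilon> > 0"
  shows "\<exists>n>0. \<forall>r>0. tpow_rat T u r - tpow_rat T u (r + 1 / of_nat n) < \<epsilon>"
proof -
  define X where "X n = tpow_rat T u (1 / of_nat (Suc n))" for n
  have X: "X n \<in> {0..1}" for n
    by (simp add: X_def del: atLeastAtMost_iff)
  have "incseq X"
    unfolding X_def by (intro incseq_SucI tpow_rat_antimono u) (auto simp: field_simps)
  then obtain L where L: "X \<longlonglongrightarrow> L" "\<And>n. X n \<le> L"
    using incseq_convergent[of X 1] X by auto
  have L_in: "L \<in> {0..1}"
    using closed_sequentially[OF closed_atLeastAtMost _ L(1)] X by blast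
  \<comment> \<open>Halving \<open>1/(n+1)\<close> gives \<open>1/(2n+2)\<close>, the term of index \<open>2n+1\<close>; in the limit, \<open>L\<close> is idempotent.\<close>
  have double: "T (X (2 * n + 1)) (X (2 * n + 1)) = X n" for n
  proof -
    have *: "1 / of_nat (Suc n) = 1 / of_nat (Suc (2 * n + 1)) + (1 / of_nat (Suc (2 * n + 1)) :: rat)"
      by (simp add: field_simps)
    show ?thesis
      unfolding X_def by (subst *, rule tpow_rat_add[OF u, symmetric]) simp_all
  qed
  have "(\<lambda>n. X (2 * n + 1)) \<longlonglongrightarrow> L"
    using LIMSEQ_subseq_LIMSEQ[OF L(1), of "\<lambda>n. 2 * n + 1"]
    by (simp add: strict_mono_def o_def)
  then have "(\<lambda>n. T (X (2 * n + 1)) (X (2 * n + 1))) \<longlonglongrightarrow> T L L"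
    using X by (intro tendsto_T)
  then have idem: "T L L = L"
    unfolding double using L(1) by (rule LIMSEQ_unique)
  have below: "tpow_rat T u r \<le> L" if r: "r > 0" for r
  proof -
    obtain n where "inverse (of_nat (Suc n)) < r"
      using reals_Archimedean[OF r] by blast
    then have "tpow_rat T u r \<le> X n"
      unfolding X_def by (intro tpow_rat_antimono u) (simp_all add: inverse_eq_divide)
    with L(2) show ?thesis
      using order_trans by blast
  qed
  have "uniformly_continuous_on ({0..1} \<times> {0..1}) (\<lambda>(x, y). T x y)"
    using cont unfolding continuous_tnorm_def
    by (intro compact_uniformly_continuous compact_Times) auto
  then obtain d where d: "d > 0" "\<And>p q. p \<in> {0..1} \<times> {0..1} \<Longrightarrow> q \<in> {0..1} \<times> {0..1} \<Longrightarrow>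
      dist q p < d \<Longrightarrow> dist (case q of (x, y) \<Rightarrow> T x y) (case p of (x, y) \<Rightarrow> T x y) < \<epsilon>"
    using e unfolding uniformly_continuous_on_def by blast
  obtain n where n: "dist (X n) L < d"
    using L(1) d(1) unfolding lim_sequentially by blast
  have "tpow_rat T u r - tpow_rat T u (r + 1 / of_nat (Suc n)) < \<epsilon>" if "r > 0" for r
  proof -
    have "dist (T (tpow_rat T u r) (X n)) (T (tpow_rat T u r) L) < \<epsilon>"
      using d(2)[of "(tpow_rat T u r, L)" "(tpow_rat T u r, X n)"] n X L_in
      by (simp add: dist_Pair_Pair del: atLeastAtMost_iff)
    moreover have "T (tpow_rat T u r) L = tpow_rat T u r"
      using idempotent_absorbs[OF L_in idem] below[OF that] by (simp del: atLeastAtMost_iff)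
    moreover have "tpow_rat T u (r + 1 / of_nat (Suc n)) = T (tpow_rat T u r) (X n)"
      unfolding X_def using that by (intro tpow_rat_add u) simp_all
    ultimately show ?thesis
      by (simp add: dist_real_def)
  qed
  then show ?thesis
    by blast
qed

lemma tpow_le:
  assumes "0 \<le> r" "of_rat r \<le> t"
  shows "tpow T u t \<le> tpow_rat T u r"
  unfolding tpow_def
proof (rule cInf_lower)
  show "bdd_below {tpow_rat T u r |r. 0 \<le> r \<and> real_of_rat r \<le> t}"
    using tpow_rat_in[of u] by (intro bdd_belowI[of _ 0]) auto
qed (use assms in auto)

lemma tpow_greatest:
  assumes "0 \<le> t" "\<And>r. 0 \<le> r \<Longrightarrow> of_rat r \<le> t \<Longrightarrow> c \<le> tpow_rat T u r"
  shows "c \<le> tpow T u t"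
  unfolding tpow_def
proof (rule cInf_greatest)
  show "{tpow_rat T u r |r. 0 \<le> r \<and> real_of_rat r \<le> t} \<noteq> {}"
    using assms(1) by (auto intro!: exI[of _ 0])
qed (use assms in auto)

lemma tpow_in [simp]: "t \<ge> 0 \<Longrightarrow> tpow T u t \<in> {0..1}"
  using tpow_greatest[of t 0 u] tpow_le[of 0 t u] tpow_rat_in[of u] by (force intro: order_trans)

lemma tpow_of_rat:
  assumes "u \<in> {0..1}" "0 \<le> r"
  shows "tpow T u (of_rat r) = tpow_rat T u r"
  using assms by (intro antisym tpow_le tpow_greatest)
    (auto simp: of_rat_less_eq intro: tpow_rat_antimono)

lemma tpow_antimono:
  assumes "0 \<le> s" "s \<le> t"
  shows "tpow T u t \<le> tpow T u s"
  using assms by (intro tpow_greatest tpow_le) auto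

text \<open>For reals \<open>s \<le> t\<close> less than \<open>1/n\<close> apart there is a rational \<open>r < s\<close> with \<open>t < r + 1/n\<close>, so
  monotonicity bounds the change between \<open>s\<close> and \<open>t\<close> by one rational step.\<close>

lemma continuous_on_tpow:
  assumes u: "u \<in> {0..1}"
  shows "continuous_on {0<..} (\<lambda>t. tpow T u t)"
proof (rule uniformly_continuous_imp_continuous, unfold uniformly_continuous_on_def, intro allI impI)
  fix \<epsilon> :: real assume "\<epsilon> > 0"
  then obtain n where n: "n > 0"
      "\<And>r. r > 0 \<Longrightarrow> tpow_rat T u r - tpow_rat T u (r + 1 / of_nat n) < \<epsilon>"
    using tpow_rat_small_step[OF u] by blast
  have step: "\<bar>tpow T u s - tpow T u t\<bar> < \<epsilon>" if "0 < s" "s \<le> t" "t - s < 1 / of_nat n" for s t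
  proof -
    have "max 0 (t - 1 / of_nat n) < s"
      using that by simp
    from of_rat_dense[OF this]
    obtain r where r: "max 0 (t - 1 / of_nat n) < of_rat r" "of_rat r < s"
      by blast
    then have "r > 0"
      by simp
    have "tpow T u s \<le> tpow_rat T u r"
      using r \<open>r > 0\<close> by (intro tpow_le) simp_all
    also have "\<dots> < tpow_rat T u (r + 1 / of_nat n) + \<epsilon>"
      using n(2)[OF \<open>r > 0\<close>] by simp
    also have "tpow_rat T u (r + 1 / of_nat n) = tpow T u (of_rat (r + 1 / of_nat n))"
      using u \<open>r > 0\<close> by (simp add: tpow_of_rat)
    also have "\<dots> \<le> tpow T u t"
      using r that by (intro tpow_antimono) (simp_all add: of_rat_add of_rat_divide)
    finally show ?thesis
      using tpow_antimono[of s t u] that by simp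
  qed
  have "dist (tpow T u t) (tpow T u s) < \<epsilon>"
    if "s \<in> {0<..}" "t \<in> {0<..}" "dist t s < 1 / of_nat n" for s t
    using step[of s t] step[of t s] that by (cases "s \<le> t") (auto simp: dist_real_def abs_if split: if_splits)
  then show "\<exists>d>0. \<forall>x\<in>{0<..}. \<forall>x'\<in>{0<..}. dist x' x < d \<longrightarrow> dist (tpow T u x') (tpow T u x) < \<epsilon>"
    using n(1) by (intro exI[of _ "1 / of_nat n"]) auto
qed

end

lemma positive_real_rat_limit:
  fixes t :: real
  assumes "t > 0"
  obtains q where "\<And>n. q n > (0::rat)" "(\<lambda>n. real_of_rat (q n)) \<longlonglongrightarrow> t"
proof -
  have "\<exists>r. t < real_of_rat r \<and> real_of_rat r < t + 1 / real (Suc n)" for n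
    by (rule of_rat_dense) simp
  then obtain q where q: "\<And>n. t < real_of_rat (q n)" "\<And>n. real_of_rat (q n) < t + 1 / real (Suc n)"
    by metis
  have upper: "(\<lambda>n. t + 1 / real (Suc n)) \<longlonglongrightarrow> t"
    using LIMSEQ_inverse_real_of_nat_add[of t] by (simp only: inverse_eq_divide)
  have "(\<lambda>n. real_of_rat (q n)) \<longlonglongrightarrow> t"
  proof (rule real_tendsto_sandwich[OF _ _ tendsto_const upper])
    show "\<forall>\<^sub>F n in sequentially. t \<le> real_of_rat (q n)"
      using q(1) by (intro always_eventually allI less_imp_le)
    show "\<forall>\<^sub>F n in sequentially. real_of_rat (q n) \<le> t + 1 / real (Suc n)"
      using q(2) by (intro always_eventually allI less_imp_le)
  qed
  moreover have "q n > 0" for n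
    using q(1)[of n] assms by (meson order.strict_trans zero_less_of_rat_iff)
  ultimately show thesis
    using that by blast
qed

context cont_tnorm
begin

lemma tendsto_tpow:
  assumes "u \<in> {0..1}" "f \<longlonglongrightarrow> t" "t > 0" "\<And>n. f n > 0"
  shows "(\<lambda>n. tpow T u (f n)) \<longlonglongrightarrow> tpow T u t"
  using continuous_on_tendsto_compose[OF continuous_on_tpow[OF assms(1)] assms(2)] assms(3,4)
  by simp

lemma tpow_add:
  assumes u: "u \<in> {0..1}" and s: "s > 0" and t: "t > 0"
  shows "tpow T u (s + t) = T (tpow T u s) (tpow T u t)"
proof -
  obtain q where q: "\<And>n. q n > 0" "(\<lambda>n. real_of_rat (q n)) \<longlonglongrightarrow> s"
    using positive_real_rat_limit[OF s] by blast
  obtain r where r: "\<And>n. r n > 0" "(\<lambda>n. real_of_rat (r n)) \<longlonglongrightarrow> t"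
    using positive_real_rat_limit[OF t] by blast
  have "(\<lambda>n. tpow T u (real_of_rat (q n) + real_of_rat (r n))) \<longlonglongrightarrow> tpow T u (s + t)"
    using q r s t u by (intro tendsto_tpow tendsto_add) (auto intro: add_pos_pos)
  moreover have "(\<lambda>n. T (tpow T u (real_of_rat (q n))) (tpow T u (real_of_rat (r n))))
      \<longlonglongrightarrow> T (tpow T u s) (tpow T u t)"
    using q r s t u by (intro tendsto_T tendsto_tpow tpow_in) (auto intro: less_imp_le)
  moreover have "tpow T u (real_of_rat (q n) + real_of_rat (r n)) =
      T (tpow T u (real_of_rat (q n))) (tpow T u (real_of_rat (r n)))" for n
    using q(1)[of n] r(1)[of n] u
    by (simp add: tpow_of_rat tpow_rat_add flip: of_rat_add)
  ultimately show ?thesis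
    by (simp add: LIMSEQ_unique)
qed

lemma pow_tpow:
  assumes "u \<in> {0..1}" "t > 0" "n > 0"
  shows "tpow_nat T (tpow T u t) n = tpow T u (of_nat n * t)"
  using assms(3)
proof (induction n rule: nat_induct_non_zero)
  case (Suc n)
  then show ?case
    using assms tpow_add[of u "of_nat n * t" t]
    by (simp add: pow_Suc algebra_simps del: atLeastAtMost_iff tpow_nat.simps(2,3))
qed simp

end

section \<open>Unique roots\<close>

text \<open>The minimum, every strict t-norm and every ordinal sum of strict t-norms satisfy the following
  condition; a nilpotent t-norm violates it, since \<open>T x x = 0\<close> for some \<open>x > 0\<close>.\<close>

locale strict_squares_tnorm = cont_tnorm +
  assumes square_strict: "x \<in> {0..1} \<Longrightarrow> y \<in> {0..1} \<Longrightarrow> x < y \<Longrightarrow> T x x < T y y"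
begin

text \<open>If \<open>x\<^sup>p = y\<^sup>p\<close>, monotonicity squeezes the mixed products \<open>T x\<^sup>p\<^sup>-\<^sup>1 y\<close> and \<open>T y\<^sup>p\<^sup>-\<^sup>1 x\<close> to the same
  value, so that one factor after the other can be exchanged in \<open>x\<^sup>p\<^sup>+\<^sup>1\<close>.\<close>

lemma equal_pow_Suc:
  assumes x: "x \<in> {0..1}" and y: "y \<in> {0..1}" and le: "x \<le> y" and p: "p > 0"
    and eq: "tpow_nat T x p = tpow_nat T y p"
  shows "tpow_nat T x (Suc p) = tpow_nat T y (Suc p)"
proof -
  obtain k where k: "p = Suc k"
    using p gr0_conv_Suc by blast
  let ?xk = "tpow_nat T x k" and ?yk = "tpow_nat T y k" and ?c = "tpow_nat T x p"
  have "?c \<le> T ?xk y" "T ?xk y \<le> T ?yk y" "?c \<le> T ?yk x" "T ?yk x \<le> T ?yk y"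
    using x y le pow_mono[OF x y le, of k] unfolding k
    by (auto simp: pow_Suc intro!: T_mono simp del: atLeastAtMost_iff tpow_nat.simps(2,3))
  moreover have "T ?yk y = ?c"
    using eq y k by (simp add: pow_Suc del: tpow_nat.simps(2,3))
  ultimately have mixed: "T ?xk y = ?c" "T ?yk x = ?c"
    by simp_all
  have "tpow_nat T x (Suc p) = T (T ?yk y) x"
    using \<open>T ?yk y = ?c\<close> x by (simp add: pow_Suc del: tpow_nat.simps(2,3))
  also have "\<dots> = T (T ?yk x) y"
    using x y by (metis T_assoc T_comm pow_in)
  also have "\<dots> = tpow_nat T y (Suc p)"
    using mixed eq y by (simp add: pow_Suc del: tpow_nat.simps(2,3))
  finally show ?thesis .
qed

text \<open>Repeated squaring keeps \<open>x < y\<close> apart at the exponents \<open>2\<^sup>n\<close>, whereas an equality at \<open>p\<close> would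
  persist at all larger exponents, \<open>2\<^sup>p\<close> among them.\<close>

lemma pow_inj:
  assumes "x \<in> {0..1}" "y \<in> {0..1}" "p > 0" "tpow_nat T x p = tpow_nat T y p"
  shows "x = y"
proof -
  have False if x: "x \<in> {0..1}" and y: "y \<in> {0..1}" and less: "x < y"
    and eq: "tpow_nat T x p = tpow_nat T y p" for x y
  proof -
    have "tpow_nat T x (p + k) = tpow_nat T y (p + k)" for k
      by (induction k) (use equal_pow_Suc[OF x y] less eq assms(3) in auto)
    from this[of "2 ^ p - p"] have "tpow_nat T x (2 ^ p) = tpow_nat T y (2 ^ p)"
      by simp
    moreover have "tpow_nat T x (2 ^ n) < tpow_nat T y (2 ^ n)" for n
    proof (induction n)
      case (Suc n)
      then show ?case
        using x y by (simp add: mult_2 pow_add square_strict del: atLeastAtMost_iff)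
    qed (use less in simp)
    ultimately show False
      by (metis less_irrefl)
  qed
  with assms show ?thesis
    by (metis linorder_neqE)
qed

lemma troot_eq:
  assumes "v \<in> {0..1}" "p > 0" "tpow_nat T v p = u"
  shows "troot T p u = v"
  using assms pow_inj[of "troot T p u" v p] pow_troot[of p u] pow_in[of v p]
  by (simp del: atLeastAtMost_iff)

lemma tpow_T_distrib:
  assumes u: "u \<in> {0..1}" and v: "v \<in> {0..1}" and t: "t > 0"
  shows "tpow T (T u v) t = T (tpow T u t) (tpow T v t)"
proof -
  have rat: "tpow_rat T (T u v) r = T (tpow_rat T u r) (tpow_rat T v r)" if r: "r > 0" for r
  proof -
    obtain a p :: nat where p: "p > 0" "r = of_nat a / of_nat p"
      using nonneg_rat_as_fraction[OF less_imp_le[OF r]] by blast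
    have "troot T p (T u v) = T (troot T p u) (troot T p v)"
      using u v p(1)
      by (intro troot_eq) (simp_all add: pow_T_distrib pow_troot del: atLeastAtMost_iff)
    then show ?thesis
      using p u v by (simp add: tpow_rat_fraction pow_T_distrib del: atLeastAtMost_iff)
  qed
  obtain q where q: "\<And>n. q n > 0" "(\<lambda>n. real_of_rat (q n)) \<longlonglongrightarrow> t"
    using positive_real_rat_limit[OF t] by blast
  have "(\<lambda>n. tpow T (T u v) (real_of_rat (q n))) \<longlonglongrightarrow> tpow T (T u v) t"
    using q t u v by (intro tendsto_tpow T_in) auto
  moreover have "(\<lambda>n. T (tpow T u (real_of_rat (q n))) (tpow T v (real_of_rat (q n))))
      \<longlonglongrightarrow> T (tpow T u t) (tpow T v t)"
    using q t u v by (intro tendsto_T tendsto_tpow tpow_in) (auto intro: less_imp_le)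
  moreover have "tpow T (T u v) (real_of_rat (q n)) =
      T (tpow T u (real_of_rat (q n))) (tpow T v (real_of_rat (q n)))" for n
    using q(1)[of n] u v by (simp add: tpow_of_rat rat less_imp_le del: atLeastAtMost_iff)
  ultimately show ?thesis
    by (simp add: LIMSEQ_unique)
qed

text \<open>For \<open>t = a/p\<close> only the outer exponent has to be rational: by additivity \<open>u\<^sup>s\<^sup>/\<^sup>p\<close> is a \<open>p\<close>-th root of
  \<open>u\<^sup>s\<close>, hence the root, and its \<open>a\<close>-th power is \<open>u\<^sup>s\<^sup>a\<^sup>/\<^sup>p\<close>. Continuity in \<open>t\<close> does the rest.\<close>

lemma tpow_tpow:
  assumes u: "u \<in> {0..1}" and s: "s > 0" and t: "t > 0"
  shows "tpow T (tpow T u s) t = tpow T u (s * t)"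
proof -
  have us: "tpow T u s \<in> {0..1}"
    using s by (simp del: atLeastAtMost_iff)
  have rat: "tpow T (tpow T u s) (of_rat r) = tpow T u (s * of_rat r)" if r: "r > 0" for r
  proof -
    obtain a p :: nat where p: "p > 0" "r = of_nat a / of_nat p"
      using nonneg_rat_as_fraction[OF less_imp_le[OF r]] by blast
    then have a: "a > 0"
      using r by (cases "a = 0") auto
    have "troot T p (tpow T u s) = tpow T u (s / of_nat p)"
      using u s p(1) by (intro troot_eq) (simp_all add: pow_tpow del: atLeastAtMost_iff)
    then have "tpow_rat T (tpow T u s) r = tpow T u (of_nat a * (s / of_nat p))"
      using p a us u s by (simp add: tpow_rat_fraction pow_tpow del: atLeastAtMost_iff)
    also have "of_nat a * (s / of_nat p) = s * of_rat r"
      using p by (simp add: of_rat_divide)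
    finally show ?thesis
      using us that by (simp add: tpow_of_rat del: atLeastAtMost_iff)
  qed
  obtain q where q: "\<And>n. q n > 0" "(\<lambda>n. real_of_rat (q n)) \<longlonglongrightarrow> t"
    using positive_real_rat_limit[OF t] by blast
  have "(\<lambda>n. tpow T (tpow T u s) (real_of_rat (q n))) \<longlonglongrightarrow> tpow T (tpow T u s) t"
    using q t us by (intro tendsto_tpow) auto
  moreover have "(\<lambda>n. tpow T u (s * real_of_rat (q n))) \<longlonglongrightarrow> tpow T u (s * t)"
    using q t s u by (intro tendsto_tpow tendsto_mult tendsto_const) auto
  ultimately show ?thesis
    using q(1) by (simp add: rat LIMSEQ_unique)
qed

end

section \<open>Strict t-norms and their ordinal sums\<close>

lemma strict_tnorm_square_strict:
  assumes "strict_tnorm T" "x \<in> {0..1}" "y \<in> {0..1}" "x < y"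
  shows "T x x < T y y"
proof -
  interpret cont_tnorm T
    using assms(1) by unfold_locales (simp add: strict_tnorm_def)
  have "T x x \<le> T y x"
    using assms by (intro T_mono) auto
  also have "\<dots> < T y y"
    using assms unfolding strict_tnorm_def by auto
  finally show ?thesis .
qed

text \<open>Inside a single block this is the strictness of the summand. Otherwise squares do not leave the
  block of \<open>y\<close> (or fix \<open>y\<close> if it lies in no block), so \<open>T y y\<close> stays above \<open>x\<close>, and \<open>T x x \<le> x\<close>.\<close>

lemma ordinal_sum_square_strict:
  assumes "continuous_tnorm T" "ordinal_sum_of_strict T"
    and x: "x \<in> {0..1}" and y: "y \<in> {0..1}" and less: "x < y"
  shows "T x x < T y y"
proof -
  interpret cont_tnorm T
    using assms(1) by unfold_locales
  obtain A :: "nat set" and T' :: "nat \<Rightarrow> real \<Rightarrow> real \<Rightarrow> real" and a e :: "nat \<Rightarrow> real" where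
    strict: "\<forall>l\<in>A. strict_tnorm (T' l)" and
    ae: "\<forall>l\<in>A. 0 \<le> a l \<and> a l < e l \<and> e l \<le> 1" and
    block: "\<forall>l\<in>A. \<forall>u\<in>{a l..e l}. \<forall>v\<in>{a l..e l}.
       T u v = a l + (e l - a l) * T' l ((u - a l) / (e l - a l)) ((v - a l) / (e l - a l))" and
    outside: "\<forall>u\<in>{0..1}. \<forall>v\<in>{0..1}.
       \<not> (\<exists>l\<in>A. u \<in> {a l..e l} \<and> v \<in> {a l..e l}) \<longrightarrow> T u v = min u v"
    using assms(2) unfolding ordinal_sum_of_strict_def
    by (elim exE conjE) (rule that; assumption)
  show ?thesis
  proof (cases "\<exists>l\<in>A. y \<in> {a l..e l}")
    case True
    then obtain l where l: "l \<in> A" "y \<in> {a l..e l}"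
      by blast
    then have al: "0 \<le> a l" "a l < e l" "e l \<le> 1" and strict_l: "strict_tnorm (T' l)"
      using ae strict by auto
    define f where "f z = (z - a l) / (e l - a l)" for z
    have f_in: "f z \<in> {0..1}" if "z \<in> {a l..e l}" for z
      using al that by (auto simp: f_def divide_simps)
    have T_f: "T z z = a l + (e l - a l) * T' l (f z) (f z)" if "z \<in> {a l..e l}" for z
      using block l(1) that unfolding f_def by blast
    show ?thesis
    proof (cases "x \<in> {a l..e l}")
      case True
      have "f x < f y"
        using al less by (simp add: f_def divide_strict_right_mono)
      then have "T' l (f x) (f x) < T' l (f y) (f y)"
        using strict_tnorm_square_strict[OF strict_l] f_in True l(2) by blast
      then show ?thesis
        using T_f[OF True] T_f[OF l(2)] al by simp
    next
      case False
      then have "x < a l"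
        using l less by auto
      moreover have "T' l (f y) (f y) \<in> {0..1}"
        using strict_l f_in[OF l(2)]
        unfolding strict_tnorm_def continuous_tnorm_def tnorm_def by blast
      then have "0 \<le> (e l - a l) * T' l (f y) (f y)"
        using al by simp
      ultimately have "x < T y y"
        using T_f[OF l(2)] by linarith
      then show ?thesis
        using T_le_left[OF x x] by simp
    qed
  next
    case False
    then have "T y y = y"
      using outside y by (metis min.idem)
    then show ?thesis
      using T_le_left[OF x x] less by simp
  qed
qed

section \<open>Dual powers\<close>

lemma spow_nat_dual: "spow_nat (dual_conorm T) x n = 1 - tpow_nat T (1 - x) n"
  by (induction "dual_conorm T" x n rule: spow_nat.induct) (simp_all add: dual_conorm_def)

lemma Inf_reflect:
  fixes X :: "real set"
  assumes "X \<noteq> {}" "bdd_above X"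
  shows "Inf ((\<lambda>x. 1 - x) ` X) = 1 - Sup X"
proof (rule cInf_eq_non_empty)
  fix y assume y: "\<And>x. x \<in> (\<lambda>x. 1 - x) ` X \<Longrightarrow> y \<le> x"
  have "Sup X \<le> 1 - y"
    using y by (intro cSup_least[OF assms(1)]) force
  then show "y \<le> 1 - Sup X"
    by simp
qed (use assms in \<open>auto intro: cSup_upper\<close>)

lemma Sup_reflect:
  fixes X :: "real set"
  assumes "X \<noteq> {}" "bdd_below X"
  shows "Sup ((\<lambda>x. 1 - x) ` X) = 1 - Inf X"
proof (rule cSup_eq_non_empty)
  fix y assume y: "\<And>x. x \<in> (\<lambda>x. 1 - x) ` X \<Longrightarrow> x \<le> y"
  have "1 - y \<le> Inf X"
    using y by (intro cInf_greatest[OF assms(1)]) force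
  then show "1 - Inf X \<le> y"
    by simp
qed (use assms in \<open>auto intro: cInf_lower\<close>)

lemma sroot_dual: "sroot (dual_conorm T) p u = 1 - troot T p (1 - u)"
proof -
  let ?V = "{v \<in> {0..1}. tpow_nat T v p < 1 - u}"
  have eq: "{v \<in> {0..1}. spow_nat (dual_conorm T) v p > u} = (\<lambda>x. 1 - x) ` ?V"
  proof (intro set_eqI iffI)
    fix v assume "v \<in> {v \<in> {0..1}. spow_nat (dual_conorm T) v p > u}"
    then show "v \<in> (\<lambda>x. 1 - x) ` ?V"
      by (intro image_eqI[of _ _ "1 - v"]) (auto simp: spow_nat_dual)
  qed (auto simp: spow_nat_dual)
  have "bdd_above ?V"
    by (auto intro: bdd_aboveI[of _ 1])
  then show ?thesis
    unfolding sroot_def troot_def Let_def eq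
    by (cases "?V = {}") (simp_all only: image_is_empty image_empty simp_thms if_True if_False Inf_reflect diff_zero not_False_eq_True)
qed

lemma spow_rat_dual: "spow_rat (dual_conorm T) u r = 1 - tpow_rat T (1 - u) r"
  by (simp add: spow_rat_def tpow_rat_def sroot_dual spow_nat_dual split: prod.split)

lemma (in cont_tnorm) spow_dual:
  assumes "t \<ge> 0"
  shows "spow (dual_conorm T) u t = 1 - tpow T (1 - u) t"
proof -
  let ?P = "{tpow_rat T (1 - u) r |r. 0 \<le> r \<and> real_of_rat r \<le> t}"
  have "{spow_rat (dual_conorm T) u r |r. 0 \<le> r \<and> real_of_rat r \<le> t} = (\<lambda>x. 1 - x) ` ?P"
    by (auto simp: spow_rat_dual)
  moreover have "?P \<noteq> {}"
    using assms by (auto intro!: exI[of _ 0])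
  moreover have "bdd_below ?P"
    using tpow_rat_in[of "1 - u"] by (intro bdd_belowI[of _ 0]) auto
  ultimately show ?thesis
    unfolding spow_def tpow_def by (simp add: Sup_reflect)
qed

section \<open>Operations on intuitionistic fuzzy values\<close>

theorem theorem8:
  fixes T :: "real \<Rightarrow> real \<Rightarrow> real"
    and \<gamma>1 \<gamma>2 \<gamma>3 :: "real \<times> real"
    and \<zeta> \<xi> lam :: real
  assumes "\<gamma>1 \<in> IFV" and "\<gamma>2 \<in> IFV" and "\<gamma>3 \<in> IFV"
    and "continuous_tnorm T"
    and "\<zeta> > 0" and "\<xi> > 0" and "lam > 0"
  shows
    "ifv_add T \<gamma>1 \<gamma>2 = ifv_add T \<gamma>2 \<gamma>1 \<and>
     ifv_mult T \<gamma>1 \<gamma>2 = ifv_mult T \<gamma>2 \<gamma>1 \<and>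
     ifv_add T (ifv_add T \<gamma>1 \<gamma>2) \<gamma>3 = ifv_add T \<gamma>1 (ifv_add T \<gamma>2 \<gamma>3) \<and>
     ifv_mult T (ifv_mult T \<gamma>1 \<gamma>2) \<gamma>3 = ifv_mult T \<gamma>1 (ifv_mult T \<gamma>2 \<gamma>3) \<and>
     ifv_add T (ifv_scale T \<xi> \<gamma>1) (ifv_scale T \<zeta> \<gamma>1) = ifv_scale T (\<xi> + \<zeta>) \<gamma>1 \<and>
     ifv_mult T (ifv_pow T \<gamma>1 \<xi>) (ifv_pow T \<gamma>1 \<zeta>) = ifv_pow T \<gamma>1 (\<xi> + \<zeta>) \<and>
     (minimum_tnorm T \<or> strict_tnorm T \<or> ordinal_sum_of_strict T \<longrightarrow>
       ifv_scale T lam (ifv_add T \<gamma>1 \<gamma>2) = ifv_add T (ifv_scale T lam \<gamma>1) (ifv_scale T lam \<gamma>2) \<and>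
       ifv_pow T (ifv_mult T \<gamma>1 \<gamma>2) lam = ifv_mult T (ifv_pow T \<gamma>1 lam) (ifv_pow T \<gamma>2 lam) \<and>
       ifv_pow T (ifv_pow T \<gamma>1 lam) \<xi> = ifv_pow T \<gamma>1 (lam * \<xi>) \<and>
       ifv_scale T \<xi> (ifv_scale T lam \<gamma>1) = ifv_scale T (lam * \<xi>) \<gamma>1)"
proof -
  interpret cont_tnorm T
    by unfold_locales fact
  obtain m1 n1 m2 n2 m3 n3 where g: "\<gamma>1 = (m1, n1)" "\<gamma>2 = (m2, n2)" "\<gamma>3 = (m3, n3)"
    by (metis surj_pair)
  have n: "n1 \<in> {0..1}" "n2 \<in> {0..1}" "n3 \<in> {0..1}" and m: "m1 \<in> {0..1}" "m2 \<in> {0..1}" "m3 \<in> {0..1}"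
    using assms(1-3) unfolding g IFV_def by auto
  have m': "1 - m1 \<in> {0..1}" "1 - m2 \<in> {0..1}" "1 - m3 \<in> {0..1}"
    and n': "1 - n1 \<in> {0..1}" "1 - n2 \<in> {0..1}" "1 - n3 \<in> {0..1}"
    using m n by simp_all
  note unit = m n m' n'
  note ops = g ifv_add_def ifv_mult_def ifv_scale_def ifv_pow_def dual_conorm_def
  have pos: "0 < \<zeta>" "0 < \<xi>" "0 < lam" "0 \<le> \<zeta>" "0 \<le> \<xi>" "0 \<le> lam" "0 \<le> \<xi> + \<zeta>" "0 \<le> lam * \<xi>"
    using assms(5-7) by simp_all
  have general:
    "ifv_add T \<gamma>1 \<gamma>2 = ifv_add T \<gamma>2 \<gamma>1"
    "ifv_mult T \<gamma>1 \<gamma>2 = ifv_mult T \<gamma>2 \<gamma>1"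
    "ifv_add T (ifv_add T \<gamma>1 \<gamma>2) \<gamma>3 = ifv_add T \<gamma>1 (ifv_add T \<gamma>2 \<gamma>3)"
    "ifv_mult T (ifv_mult T \<gamma>1 \<gamma>2) \<gamma>3 = ifv_mult T \<gamma>1 (ifv_mult T \<gamma>2 \<gamma>3)"
    using unit by (simp_all add: ops T_assoc T_comm T_left_commute del: atLeastAtMost_iff)
  have exponents:
    "ifv_add T (ifv_scale T \<xi> \<gamma>1) (ifv_scale T \<zeta> \<gamma>1) = ifv_scale T (\<xi> + \<zeta>) \<gamma>1"
    "ifv_mult T (ifv_pow T \<gamma>1 \<xi>) (ifv_pow T \<gamma>1 \<zeta>) = ifv_pow T \<gamma>1 (\<xi> + \<zeta>)"
    using unit pos by (simp_all add: ops spow_dual tpow_add del: atLeastAtMost_iff)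
  have special:
    "ifv_scale T lam (ifv_add T \<gamma>1 \<gamma>2) = ifv_add T (ifv_scale T lam \<gamma>1) (ifv_scale T lam \<gamma>2) \<and>
     ifv_pow T (ifv_mult T \<gamma>1 \<gamma>2) lam = ifv_mult T (ifv_pow T \<gamma>1 lam) (ifv_pow T \<gamma>2 lam) \<and>
     ifv_pow T (ifv_pow T \<gamma>1 lam) \<xi> = ifv_pow T \<gamma>1 (lam * \<xi>) \<and>
     ifv_scale T \<xi> (ifv_scale T lam \<gamma>1) = ifv_scale T (lam * \<xi>) \<gamma>1"
    if "minimum_tnorm T \<or> strict_tnorm T \<or> ordinal_sum_of_strict T"
  proof -
    interpret strict_squares_tnorm T
    proof unfold_locales
      fix x y :: real assume "x \<in> {0..1}" "y \<in> {0..1}" "x < y"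
      then show "T x x < T y y"
        using that assms(4) strict_tnorm_square_strict ordinal_sum_square_strict
        by (auto simp: minimum_tnorm_def simp del: atLeastAtMost_iff)
    qed
    show ?thesis
      using unit pos
      by (simp add: ops spow_dual tpow_T_distrib tpow_tpow del: atLeastAtMost_iff)
  qed
  from general exponents special show ?thesis
    by blast
qed

end
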